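(* Let $\psi$ be a homomorphism such that the induced abstract process $P_\psi$ is an MDP. Then for all $h\in\mathcal H$, $a\in\mathcal A$ and $(s,b)=\psi(h,a)$: (i) $q^*(s,b)=Q^*(h,a)$ and $v^*(s)=V^*(h)$. (ii) $V^*(h)=V^{\breve\Pi}(h)$, where $\breve\Pi$ is a deterministic policy with $\breve\Pi(h)\in\psi_s^{-1}(\pi^*(s))$ for any $h$ with $\psi(h)=s$, and $\pi^*:\mathcal S\to\mathcal B$ is a deterministic optimal abstract policy.
   Context: Setting. $\mathcal A$ (actions), $\mathcal O$ (observations), $\mathcal R\subseteq[0,1]$ (rewards) are finite sets; $\gamma\in[0,1)$; $\Delta(X)$ is the set of probability distributions on $X$. $\mathcal H:=\bigcup_{t\ge0}(\mathcal A\times\mathcal O\times\mathcal R)^t$ is the set of histories. The original process is a map $P:\mathcal H\times\mathcal A\to\Delta(\mathcal O\times\mathcal R)$, written $P(or|ha)$ (arbitrary dependence on the history). A policy is a map $\Pi:\mathcal H\to\Delta(\mathcal A)$. Its (action-)value functions are given by $Q^\Pi(h,a)=\sum_{o,r}P(or|ha)\,(r+\gamma V^\Pi(haor))$ and $V^\Pi(h)=\sum_{a}Q^\Pi(h,a)\Pi(a|h)$, where $haor$ is the history $h$ extended by $(a,o,r)$. $Q^*,V^*$ are the (action-)value functions of an optimal policy $\Pi^*$ (one maximizing $V^\Pi$); thus $V^*(h)=\max_aQ^*(h,a)$. Homomorphism. $\mathcal S$ and $\mathcal B$ are finite sets (abstract states and abstract actions). A homomorphism is a surjective map $\psi:\mathcal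 H\times\mathcal A\to\mathcal S\times\mathcal B$ whose state component depends only on the history: $\psi(h,a)=(f(h),b)$ for a fixed surjective $f:\mathcal H\to\mathcal S$ (while $b$ may depend on both $h$ and $a$). Write $\psi(h)=s$ for $f(h)=s$, and, for $f(h)=s$, $\psi_s^{-1}(b):=\{a\in\mathcal A:\psi(h,a)=(s,b)\}$ (it depends on $h$). The induced abstract process is $P_\psi(s'r|ha):=\sum_{o:\psi(haor)=s'}P(or|ha)$. $P_\psi$ is an MDP if there is $p_{\mathrm{MDP}}:\mathcal S\times\mathcal B\to\Delta(\mathcal S\times\mathcal R)$ with $P_\psi(s'r|ha)=p_{\mathrm{MDP}}(s'r|sb)$ for all $\psi(h,a)=(s,b)$ and all $s'\in\mathcal S,r\in\mathcal R$. For an abstract policy $\pi:\mathcal S\to\Delta(\mathcal B)$, $q^\pi,v^\pi$ are given by $q^\pi(s,b)=\sum_{s',r}p_{\mathrm{MDP}}(s'r|sb)(r+\gamma v^\pi(s'))$, $v^\pi(s)=\sum_bq^\pi(s,b)\pi(b|s)$. An abstract policy is optimal if it maximizes $v^\pi$; $q^*,v^*$ are the (action-)value functions of an optimal abstract policy.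
   Formalization: Added assumption: for every deterministic optimal abstract policy π* and every history h with ψ(h)=s, the set ψ_s^{-1}(π*(s)) is nonempty; surjectivity of ψ alone does not ensure this, and (i) can fail without it. *)

theory Defs
  imports "HOL-Probability.Probability"
begin

(* Actions, observations, abstract states and abstract actions are finite types; the rewards
   form an explicit set R of reals. Histories are lists, oldest step first, and only lists whose
   rewards lie in R are genuine histories. *)

type_synonym ('a, 'o) history = "('a \<times> 'o \<times> real) list"

definition histories :: "real set \<Rightarrow> ('a, 'o) history set" where
  "histories R = lists (UNIV \<times> UNIV \<times> R)"

type_synonym ('a, 'o) process = "('a, 'o) history \<Rightarrow> 'a \<Rightarrow> ('o \<times> real) pmf"

definition is_process :: "real set \<Rightarrow> ('a, 'o) process \<Rightarrow> bool" where
  "is_process R P \<longleftrightarrow> (\<forall>h\<in>histories R. \<forall>a. set_pmf (P h a) \<subseteq> UNIV \<times> R)"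

type_synonym ('a, 'o) policy = "('a, 'o) history \<Rightarrow> 'a pmf"

definition Q_backup ::
  "real set \<Rightarrow> real \<Rightarrow> ('a, 'o::finite) process \<Rightarrow> (('a, 'o) history \<Rightarrow> real) \<Rightarrow> ('a, 'o) history \<Rightarrow> 'a \<Rightarrow> real"
where
  "Q_backup R \<gamma> P V h a =
     (\<Sum>(ob, r)\<in>UNIV \<times> R. pmf (P h a) (ob, r) * (r + \<gamma> * V (h @ [(a, ob, r)])))"

(* On infinitely many histories the Bellman equations also have unbounded solutions; the value
   function is the bounded one, which is unique for 0 <= gamma < 1 and finite R. The equations
   are imposed on all lists so that this solution is unique as a total function; its restriction
   to the genuine histories does not depend on the behaviour of P or the policy elsewhere. *)

definition V_pol ::
  "real set \<Rightarrow> real \<Rightarrow> ('a::finite, 'o::finite) process \<Rightarrow> ('a, 'o) policy \<Rightarrow> ('a, 'o) history \<Rightarrow> real"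
where
  "V_pol R \<gamma> P pol =
     (THE V. bounded (range V) \<and> (\<forall>h. V h = (\<Sum>a\<in>UNIV. Q_backup R \<gamma> P V h a * pmf (pol h) a)))"

definition Q_pol ::
  "real set \<Rightarrow> real \<Rightarrow> ('a::finite, 'o::finite) process \<Rightarrow> ('a, 'o) policy \<Rightarrow> ('a, 'o) history \<Rightarrow> 'a \<Rightarrow> real"
where
  "Q_pol R \<gamma> P pol = Q_backup R \<gamma> P (V_pol R \<gamma> P pol)"

definition optimal_policy ::
  "real set \<Rightarrow> real \<Rightarrow> ('a::finite, 'o::finite) process \<Rightarrow> ('a, 'o) policy \<Rightarrow> bool"
where
  "optimal_policy R \<gamma> P pol \<longleftrightarrow> (\<forall>pol'. \<forall>h\<in>histories R. V_pol R \<gamma> P pol' h \<le> V_pol R \<gamma> P pol h)"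

(* All optimal policies have the same values on histories, so the choice is immaterial there. *)

definition V_opt ::
  "real set \<Rightarrow> real \<Rightarrow> ('a::finite, 'o::finite) process \<Rightarrow> ('a, 'o) history \<Rightarrow> real"
where
  "V_opt R \<gamma> P = V_pol R \<gamma> P (SOME pol. optimal_policy R \<gamma> P pol)"

definition Q_opt ::
  "real set \<Rightarrow> real \<Rightarrow> ('a::finite, 'o::finite) process \<Rightarrow> ('a, 'o) history \<Rightarrow> 'a \<Rightarrow> real"
where
  "Q_opt R \<gamma> P = Q_pol R \<gamma> P (SOME pol. optimal_policy R \<gamma> P pol)"

definition homomorphism ::
  "real set \<Rightarrow> (('a, 'o) history \<times> 'a \<Rightarrow> 's \<times> 'b) \<Rightarrow> (('a, 'o) history \<Rightarrow> 's) \<Rightarrow> bool"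
where
  "homomorphism R \<psi> f \<longleftrightarrow>
     \<psi> ` (histories R \<times> UNIV) = UNIV \<and>
     f ` histories R = UNIV \<and>
     (\<forall>h\<in>histories R. \<forall>a. fst (\<psi> (h, a)) = f h)"

definition action_fibre ::
  "(('a, 'o) history \<times> 'a \<Rightarrow> 's \<times> 'b) \<Rightarrow> ('a, 'o) history \<Rightarrow> 's \<Rightarrow> 'b \<Rightarrow> 'a set"
where
  "action_fibre \<psi> h s b = {a. \<psi> (h, a) = (s, b)}"

definition P_abs ::
  "('a, 'o::finite) process \<Rightarrow> (('a, 'o) history \<Rightarrow> 's) \<Rightarrow> ('a, 'o) history \<Rightarrow> 'a \<Rightarrow> 's \<Rightarrow> real \<Rightarrow> real"
where
  "P_abs P f h a s' r = (\<Sum>ob | f (h @ [(a, ob, r)]) = s'. pmf (P h a) (ob, r))"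

type_synonym ('s, 'b) mdp = "'s \<Rightarrow> 'b \<Rightarrow> ('s \<times> real) pmf"

definition abs_is_MDP ::
  "real set \<Rightarrow> ('a, 'o::finite) process \<Rightarrow> (('a, 'o) history \<times> 'a \<Rightarrow> 's \<times> 'b) \<Rightarrow>
   (('a, 'o) history \<Rightarrow> 's) \<Rightarrow> ('s, 'b) mdp \<Rightarrow> bool"
where
  "abs_is_MDP R P \<psi> f p \<longleftrightarrow>
     (\<forall>s b. set_pmf (p s b) \<subseteq> UNIV \<times> R) \<and>
     (\<forall>h\<in>histories R. \<forall>a s b. \<psi> (h, a) = (s, b) \<longrightarrow>
        (\<forall>s'. \<forall>r\<in>R. P_abs P f h a s' r = pmf (p s b) (s', r)))"

definition q_backup ::
  "real set \<Rightarrow> real \<Rightarrow> ('s::finite, 'b) mdp \<Rightarrow> ('s \<Rightarrow> real) \<Rightarrow> 's \<Rightarrow> 'b \<Rightarrow> real"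
where
  "q_backup R \<gamma> p v s b = (\<Sum>(s', r)\<in>UNIV \<times> R. pmf (p s b) (s', r) * (r + \<gamma> * v s'))"

definition v_pol ::
  "real set \<Rightarrow> real \<Rightarrow> ('s::finite, 'b::finite) mdp \<Rightarrow> ('s \<Rightarrow> 'b pmf) \<Rightarrow> 's \<Rightarrow> real"
where
  "v_pol R \<gamma> p \<pi> = (THE v. \<forall>s. v s = (\<Sum>b\<in>UNIV. q_backup R \<gamma> p v s b * pmf (\<pi> s) b))"

definition q_pol ::
  "real set \<Rightarrow> real \<Rightarrow> ('s::finite, 'b::finite) mdp \<Rightarrow> ('s \<Rightarrow> 'b pmf) \<Rightarrow> 's \<Rightarrow> 'b \<Rightarrow> real"
where
  "q_pol R \<gamma> p \<pi> = q_backup R \<gamma> p (v_pol R \<gamma> p \<pi>)"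

definition optimal_abs_policy ::
  "real set \<Rightarrow> real \<Rightarrow> ('s::finite, 'b::finite) mdp \<Rightarrow> ('s \<Rightarrow> 'b pmf) \<Rightarrow> bool"
where
  "optimal_abs_policy R \<gamma> p \<pi> \<longleftrightarrow> (\<forall>\<pi>' s. v_pol R \<gamma> p \<pi>' s \<le> v_pol R \<gamma> p \<pi> s)"

definition v_opt :: "real set \<Rightarrow> real \<Rightarrow> ('s::finite, 'b::finite) mdp \<Rightarrow> 's \<Rightarrow> real" where
  "v_opt R \<gamma> p = v_pol R \<gamma> p (SOME \<pi>. optimal_abs_policy R \<gamma> p \<pi>)"

definition q_opt :: "real set \<Rightarrow> real \<Rightarrow> ('s::finite, 'b::finite) mdp \<Rightarrow> 's \<Rightarrow> 'b \<Rightarrow> real" where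
  "q_opt R \<gamma> p = q_pol R \<gamma> p (SOME \<pi>. optimal_abs_policy R \<gamma> p \<pi>)"

(* Deterministic policies are functions into actions, viewed as policies via point masses. *)

definition det_policy :: "('x \<Rightarrow> 'y) \<Rightarrow> 'x \<Rightarrow> 'y pmf" where
  "det_policy g x = return_pmf (g x)"

definition lifts_policy ::
  "real set \<Rightarrow> (('a, 'o) history \<times> 'a \<Rightarrow> 's \<times> 'b) \<Rightarrow> (('a, 'o) history \<Rightarrow> 's) \<Rightarrow>
   ('s \<Rightarrow> 'b) \<Rightarrow> (('a, 'o) history \<Rightarrow> 'a) \<Rightarrow> bool"
where
  "lifts_policy R \<psi> f \<pi> pol \<longleftrightarrow>
     (\<forall>h\<in>histories R. \<forall>s. f h = s \<longrightarrow> pol h \<in> action_fibre \<psi> h s (\<pi> s))"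

end

theory Submission
  imports Defs
begin

text \<open>
  The MDP property says exactly that backing up a function of the abstract state on the history
  level at (h, a) is the same as backing it up on the abstract level at \<psi> (h, a). Hence
  v* \<circ> f satisfies the optimality equation on histories as soon as some action realises the
  abstract maximum, which non-emptiness of the fibres over a greedy (hence optimal) abstract
  policy provides; likewise v* \<circ> f satisfies the policy equation of the lifted policy.
  Contraction makes bounded solutions unique.
\<close>

section \<open>Contraction arguments and unique bounded fixed points\<close>

text \<open>Iterating \<open>step\<close> shrinks the initial gap to \<gamma>^n * |C|, which tends
  to 0. The absolute value makes the initial gap nonnegative, as \<open>step\<close> demands. The
  set \<open>X\<close> allows a comparison on genuine histories alone.\<close>

lemma le_of_discounted_improvement:
  fixes V W :: "'x \<Rightarrow> real"
  assumes gamma: "0 \<le> \<gamma>" "\<gamma> < 1"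
    and C: "\<And>x. x \<in> X \<Longrightarrow> V x \<le> W x + C"
    and step: "\<And>c x. 0 \<le> c \<Longrightarrow> (\<And>y. y \<in> X \<Longrightarrow> V y \<le> W y + c) \<Longrightarrow> x \<in> X \<Longrightarrow> V x \<le> W x + \<gamma> * c"
    and x: "x \<in> X"
  shows "V x \<le> W x"
proof -
  have "\<forall>x\<in>X. V x \<le> W x + \<gamma> ^ n * \<bar>C\<bar>" for n
  proof (induction n)
    case 0
    then show ?case using C by (force intro: order_trans)
  next
    case (Suc n)
    have "0 \<le> \<gamma> ^ n * \<bar>C\<bar>" using gamma by simp
    with step[of "\<gamma> ^ n * \<bar>C\<bar>"] Suc show ?case by (auto simp: mult.assoc)
  qed
  then have le: "\<And>n. V x \<le> W x + \<gamma> ^ n * \<bar>C\<bar>" using x by blast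
  have "(\<lambda>n. W x + \<gamma> ^ n * \<bar>C\<bar>) \<longlonglongrightarrow> W x + 0 * \<bar>C\<bar>"
    using gamma by (intro tendsto_intros LIMSEQ_power_zero) auto
  then show ?thesis
    using LIMSEQ_le_const[of _ "W x" "V x"] le by auto
qed

text \<open>Banach's fixed point theorem in the supremum metric. The one-sided hypothesis
  \<open>contr\<close> packs monotonicity (c = 0) and discounting together, as in Blackwell's
  conditions; used in both directions it makes \<open>T\<close> Lipschitz with constant
  \<gamma>.\<close>

lemma ex1_bounded_fixpoint:
  fixes T :: "('x \<Rightarrow> real) \<Rightarrow> 'x \<Rightarrow> real"
  assumes gamma: "0 \<le> \<gamma>" "\<gamma> < 1"
    and contr: "\<And>V W c x. 0 \<le> c \<Longrightarrow> (\<And>y. V y \<le> W y + c) \<Longrightarrow> T V x \<le> T W x + \<gamma> * c"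
    and bounded0: "\<And>x. \<bar>T (\<lambda>_. 0) x\<bar> \<le> K"
  shows "\<exists>!V. bounded (range V) \<and> (\<forall>x. V x = T V x)"
proof -
  have contr': "\<bar>T V x - T W x\<bar> \<le> \<gamma> * c" if "0 \<le> c" "\<And>y. \<bar>V y - W y\<bar> \<le> c" for V W c x
  proof -
    have "V y \<le> W y + c" "W y \<le> V y + c" for y using that(2)[of y] by auto
    then show ?thesis
      using contr[of c V W x] contr[of c W V x] that(1) by fastforce
  qed
  \<comment> \<open>The state type carries no topology. On its discrete copy every function is
    continuous, so bounded functions become the complete space of bounded continuous functions, on
    which \<open>F\<close> is \<open>T\<close>.\<close>
  define F :: "('x discrete \<Rightarrow>\<^sub>C real) \<Rightarrow> 'x discrete \<Rightarrow>\<^sub>C real" where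
    "F u = Bcontfun (\<lambda>d. T (\<lambda>x. apply_bcontfun u (discrete x)) (of_discrete d))" for u
  have bcont: "(\<lambda>d. V (of_discrete d)) \<in> bcontfun" if "bounded (range V)" for V :: "'x \<Rightarrow> real"
  proof -
    have "bounded (range (\<lambda>d. V (of_discrete d)))"
      using that by (rule bounded_subset) auto
    then show ?thesis
      by (simp add: bcontfun_def continuous_on_open_vimage Discrete_Topology.open_discrete)
  qed
  \<comment> \<open>\<open>F\<close> is well defined because \<open>T\<close> preserves boundedness:
    \<open>T V\<close> stays within \<gamma> * B of \<open>T 0\<close>, which is bounded by
    \<open>K\<close>.\<close>
  have T_bdd: "bounded (range (T V))" if V: "bounded (range V)" for V
  proof -
    obtain B where B: "\<And>x. \<bar>V x\<bar> \<le> B" using V by (auto simp: bounded_iff)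
    then have "0 \<le> B" by (meson abs_ge_zero order_trans)
    have "\<bar>T V x\<bar> \<le> K + \<gamma> * B" for x
      using contr'[of B V "\<lambda>_. 0" x] B bounded0[of x] \<open>0 \<le> B\<close> by fastforce
    then show ?thesis by (auto simp: bounded_iff)
  qed
  have F_apply: "apply_bcontfun (F u) d = T (\<lambda>x. apply_bcontfun u (discrete x)) (of_discrete d)" for u d
  proof -
    have "bounded (range (\<lambda>x. apply_bcontfun u (discrete x)))"
      using bounded_apply_bcontfun[of u] by (rule bounded_subset) auto
    from bcont[OF T_bdd[OF this]] show ?thesis
      unfolding F_def by (simp add: Bcontfun_inverse)
  qed
  have "dist (F u) (F v) \<le> \<gamma> * dist u v" for u v
  proof (rule dist_bound)
    fix d
    show "dist (apply_bcontfun (F u) d) (apply_bcontfun (F v) d) \<le> \<gamma> * dist u v"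
      unfolding F_apply dist_real_def
      by (rule contr') (simp_all add: dist_real_def[symmetric] dist_bounded)
  qed
  then have ex1: "\<exists>!u. F u = u"
    using gamma by (intro banach_fix_type) auto
  then obtain u where u: "F u = u" by blast
  show ?thesis
  proof (rule ex1I[of _ "\<lambda>x. apply_bcontfun u (discrete x)"])
    have "bounded (range (\<lambda>x. apply_bcontfun u (discrete x)))"
      using bounded_apply_bcontfun[of u] by (rule bounded_subset) auto
    moreover have "apply_bcontfun u (discrete x) = T (\<lambda>x. apply_bcontfun u (discrete x)) x" for x
      using F_apply[of u "discrete x"] u by (simp add: discrete_inverse)
    ultimately show "bounded (range (\<lambda>x. apply_bcontfun u (discrete x))) \<and>
        (\<forall>x. apply_bcontfun u (discrete x) = T (\<lambda>x. apply_bcontfun u (discrete x)) x)"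
      by blast
  next
    fix V assume V: "bounded (range V) \<and> (\<forall>x. V x = T V x)"
    define w where "w = Bcontfun (\<lambda>d. V (of_discrete d))"
    have w: "apply_bcontfun w d = V (of_discrete d)" for d
      unfolding w_def by (simp add: Bcontfun_inverse[OF bcont[OF conjunct1[OF V]]])
    have "T V = V"
      using V by auto
    then have "F w = w"
      by (intro bcontfun_eqI) (simp add: F_apply w discrete_inverse)
    with u ex1 have "w = u" by blast
    then show "V = (\<lambda>x. apply_bcontfun u (discrete x))"
      using w by (auto simp: discrete_inverse)
  qed
qed

lemma bounded_le_plus:
  fixes V W :: "'a \<Rightarrow> real"
  assumes "bounded (range V)" "bounded (range W)"
  obtains C where "\<And>x. V x \<le> W x + C"
proof -
  obtain a b where "\<And>x. \<bar>V x\<bar> \<le> a" "\<And>x. \<bar>W x\<bar> \<le> b"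
    using assms by (auto simp: bounded_iff)
  then have "V x \<le> W x + (a + b)" for x
    using abs_le_D1[of "V x" a] abs_le_D2[of "W x" b] by (smt (verit))
  then show thesis by (rule that)
qed

text \<open>Averaging and maximisation both let an additive constant pass through. With
  \<open>Max_le_Max_plus\<close>, this gives the policy operator and the optimality operator the
  one-sided contraction property of a single backup.\<close>

lemma average_le:
  fixes g :: "'a::finite \<Rightarrow> real"
  assumes "\<And>a. g a \<le> k a + c"
  shows "(\<Sum>a\<in>UNIV. g a * pmf q a) \<le> (\<Sum>a\<in>UNIV. k a * pmf q a) + c"
proof -
  have "(\<Sum>a\<in>UNIV. g a * pmf q a) \<le> (\<Sum>a\<in>UNIV. (k a + c) * pmf q a)"
    using assms by (intro sum_mono mult_right_mono) auto
  also have "\<dots> = (\<Sum>a\<in>UNIV. k a * pmf q a) + c * (\<Sum>a\<in>UNIV. pmf q a)"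
    by (simp add: distrib_right sum.distrib sum_distrib_left)
  also have "(\<Sum>a\<in>UNIV. pmf q a) = 1"
    by (rule sum_pmf_eq_1) auto
  finally show ?thesis by simp
qed

lemma Max_le_Max_plus:
  fixes g :: "'a::finite \<Rightarrow> real"
  assumes "\<And>a. g a \<le> k a + c"
  shows "(MAX a. g a) \<le> (MAX a. k a) + c"
proof -
  have "k a \<le> (MAX a. k a)" for a
    by (rule Max_ge) auto
  then have "g a \<le> (MAX a. k a) + c" for a
    using assms[of a] by (smt (verit))
  then show ?thesis by simp
qed

section \<open>Discounted decision processes\<close>

text \<open>A common frame for the history process and the abstract MDP, which differ only in how an
  outcome determines the next state.\<close>

locale decision_process =
  fixes K :: "'x \<Rightarrow> 'a::finite \<Rightarrow> ('y \<times> real) pmf"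
    and t :: "'x \<Rightarrow> 'a \<Rightarrow> 'y \<times> real \<Rightarrow> 'x"
    and A :: "('y \<times> real) set"
    and \<gamma> :: real
  assumes gamma: "0 \<le> \<gamma>" "\<gamma> < 1"
    and finite_A: "finite A"
    and reward: "\<And>z. z \<in> A \<Longrightarrow> 0 \<le> snd z \<and> snd z \<le> 1"
begin

definition backup :: "('x \<Rightarrow> real) \<Rightarrow> 'x \<Rightarrow> 'a \<Rightarrow> real" where
  "backup V x a = (\<Sum>z\<in>A. pmf (K x a) z * (snd z + \<gamma> * V (t x a z)))"

text \<open>Only an inequality, since off the genuine histories a process may put mass outside
  \<open>A\<close>. It suffices for contraction because the shift c is nonnegative.\<close>

lemma sum_pmf_le_1: "(\<Sum>z\<in>A. pmf (K x a) z) \<le> 1"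
  using measure_measure_pmf_finite[OF finite_A, of "K x a"] by (metis measure_pmf.prob_le_1)

lemma backup_le:
  assumes "0 \<le> c" and le: "\<And>z. z \<in> A \<Longrightarrow> V (t x a z) \<le> W (t x a z) + c"
  shows "backup V x a \<le> backup W x a + \<gamma> * c"
proof -
  have "backup V x a \<le> (\<Sum>z\<in>A. pmf (K x a) z * (snd z + \<gamma> * (W (t x a z) + c)))"
    unfolding backup_def using le gamma by (intro sum_mono mult_left_mono add_mono) auto
  also have "\<dots> = backup W x a + (\<Sum>z\<in>A. pmf (K x a) z) * (\<gamma> * c)"
    unfolding backup_def sum_distrib_right sum.distrib[symmetric]
    by (rule sum.cong) (simp_all add: algebra_simps)
  also have "\<dots> \<le> backup W x a + \<gamma> * c"
    using sum_pmf_le_1 gamma \<open>0 \<le> c\<close> by (simp add: mult_left_le_one_le sum_nonneg)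
  finally show ?thesis .
qed

lemma backup_cong:
  "(\<And>z. z \<in> A \<Longrightarrow> V (t x a z) = W (t x a z)) \<Longrightarrow> backup V x a = backup W x a"
  unfolding backup_def by simp

lemma backup_zero: "0 \<le> backup (\<lambda>_. 0) x a" "backup (\<lambda>_. 0) x a \<le> 1"
proof -
  show "0 \<le> backup (\<lambda>_. 0) x a"
    unfolding backup_def using reward by (auto intro!: sum_nonneg)
  have "backup (\<lambda>_. 0) x a \<le> (\<Sum>z\<in>A. pmf (K x a) z)"
    unfolding backup_def using reward by (intro sum_mono) (auto simp: mult_left_le)
  then show "backup (\<lambda>_. 0) x a \<le> 1" using sum_pmf_le_1[of x a] by linarith
qed

definition policy_value :: "('x \<Rightarrow> 'a pmf) \<Rightarrow> 'x \<Rightarrow> real" where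
  "policy_value pol =
     (THE V. bounded (range V) \<and> (\<forall>x. V x = (\<Sum>a\<in>UNIV. backup V x a * pmf (pol x) a)))"

text \<open>The optimum is introduced through the Bellman optimality equation, without mention of
  policies; \<open>dominating_policy_iff\<close> makes the connection to optimal policies.\<close>

definition optimal_value :: "'x \<Rightarrow> real" where
  "optimal_value = (THE V. bounded (range V) \<and> (\<forall>x. V x = (MAX a. backup V x a)))"

lemma ex1_policy_value:
  "\<exists>!V. bounded (range V) \<and> (\<forall>x. V x = (\<Sum>a\<in>UNIV. backup V x a * pmf (pol x) a))"
proof (rule ex1_bounded_fixpoint[OF gamma])
  fix x
  show "\<bar>\<Sum>a\<in>UNIV. backup (\<lambda>_. 0) x a * pmf (pol x) a\<bar> \<le> 1"
    using average_le[of "backup (\<lambda>_. 0) x" "\<lambda>_. 0" 1 "pol x"] backup_zero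
    by (simp add: sum_nonneg)
qed (intro average_le backup_le)

lemma ex1_optimal_value:
  "\<exists>!V. bounded (range V) \<and> (\<forall>x. V x = (MAX a. backup V x a))"
proof (rule ex1_bounded_fixpoint[OF gamma])
  fix x
  have "(MAX a. backup (\<lambda>_. 0) x a) \<in> range (backup (\<lambda>_. 0) x)"
    by (rule Max_in) auto
  then obtain a where "(MAX a. backup (\<lambda>_. 0) x a) = backup (\<lambda>_. 0) x a"
    by blast
  then show "\<bar>MAX a. backup (\<lambda>_. 0) x a\<bar> \<le> 1"
    using backup_zero[of x a] by linarith
qed (intro Max_le_Max_plus backup_le)

lemma policy_value_bounded: "bounded (range (policy_value pol))"
  and policy_value_eq:
    "policy_value pol x = (\<Sum>a\<in>UNIV. backup (policy_value pol) x a * pmf (pol x) a)"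
  using theI'[OF ex1_policy_value[of pol]] unfolding policy_value_def[symmetric] by auto

lemma policy_value_unique:
  "bounded (range V) \<Longrightarrow> (\<And>x. V x = (\<Sum>a\<in>UNIV. backup V x a * pmf (pol x) a)) \<Longrightarrow>
    V = policy_value pol"
  using ex1_policy_value[of pol] policy_value_bounded[of pol] policy_value_eq[of pol] by blast

lemma optimal_value_bounded: "bounded (range optimal_value)"
  and optimal_value_eq: "optimal_value x = (MAX a. backup optimal_value x a)"
  using theI'[OF ex1_optimal_value] unfolding optimal_value_def[symmetric] by auto

lemma backup_le_optimal_value: "backup optimal_value x a \<le> optimal_value x"
  unfolding optimal_value_eq[of x] by (rule Max_ge) auto

text \<open>The value of a policy is an average of its backups. If it exceeds the optimum by at most
  c everywhere, each backup exceeds it by at most \<gamma> * c, and hence so does the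
  average.\<close>

lemma policy_value_le_optimal_value: "policy_value pol x \<le> optimal_value x"
proof -
  obtain C where C: "\<And>x. policy_value pol x \<le> optimal_value x + C"
    using bounded_le_plus[OF policy_value_bounded optimal_value_bounded] by blast
  show ?thesis
  proof (rule le_of_discounted_improvement[where X = UNIV and V = "policy_value pol"
        and W = optimal_value, OF gamma])
    fix c x
    assume "0 \<le> c" and le: "\<And>y. y \<in> UNIV \<Longrightarrow> policy_value pol y \<le> optimal_value y + c"
    have "backup (policy_value pol) x a \<le> optimal_value x + \<gamma> * c" for a
      using backup_le[of c "policy_value pol" x a optimal_value] backup_le_optimal_value[of x a]
        \<open>0 \<le> c\<close> le by fastforce
    from average_le[of "backup (policy_value pol) x" "\<lambda>_. optimal_value x", OF this]
    have "policy_value pol x \<le> (\<Sum>a\<in>UNIV. optimal_value x * pmf (pol x) a) + \<gamma> * c"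
      by (subst policy_value_eq)
    also have "(\<Sum>a\<in>UNIV. optimal_value x * pmf (pol x) a) = optimal_value x"
      by (simp add: sum_distrib_left[symmetric] sum_pmf_eq_1)
    finally show "policy_value pol x \<le> optimal_value x + \<gamma> * c" .
  qed (use C in auto)
qed

lemma policy_value_det:
  "policy_value (det_policy g) x = backup (policy_value (det_policy g)) x (g x)"
  by (subst policy_value_eq) (simp add: det_policy_def pmf_return indicator_def)

text \<open>For a greedy \<open>g\<close> the optimal value solves the policy equation of
  \<open>g\<close>, whose bounded solution is unique.\<close>

lemma policy_value_greedy:
  assumes "\<And>x. backup optimal_value x (g x) = optimal_value x"
  shows "policy_value (det_policy g) = optimal_value"
  using assms
  by (intro policy_value_unique[symmetric])
    (auto simp: optimal_value_bounded det_policy_def pmf_return indicator_def)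

lemma ex_greedy: "\<exists>g. \<forall>x. backup optimal_value x (g x) = optimal_value x"
proof (rule choice, rule allI)
  fix x
  have "(MAX a. backup optimal_value x a) \<in> range (backup optimal_value x)"
    by (rule Max_in) auto
  then show "\<exists>a. backup optimal_value x a = optimal_value x"
    unfolding optimal_value_eq[of x, symmetric] by force
qed

text \<open>A greedy policy is among the competitors and attains the upper bound everywhere. The set
  \<open>X\<close> serves both notions of optimality: on genuine histories and on all abstract
  states.\<close>

lemma dominating_policy_iff:
  "(\<forall>pol'. \<forall>x\<in>X. policy_value pol' x \<le> policy_value pol x) \<longleftrightarrow>
    (\<forall>x\<in>X. policy_value pol x = optimal_value x)"
proof -
  obtain g where "policy_value (det_policy g) = optimal_value"
    using ex_greedy policy_value_greedy by blast
  then show ?thesis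
    using policy_value_le_optimal_value by (metis order_antisym)
qed

end

section \<open>Transfer of values along the homomorphism\<close>

text \<open>Surjectivity of \<psi> realises a pair (s, b) at some history over s.
  \<open>fibres_nonempty\<close> realises the choice of an optimal deterministic abstract policy at
  every history over s, so that it can be imitated there.\<close>

locale mdp_homomorphism =
  fixes R :: "real set" and \<gamma> :: real
    and P :: "('a::finite, 'o::finite) process"
    and \<psi> :: "('a, 'o) history \<times> 'a \<Rightarrow> 's::finite \<times> 'b::finite"
    and f :: "('a, 'o) history \<Rightarrow> 's"
    and p :: "('s, 'b) mdp"
  assumes R: "finite R" "R \<subseteq> {0..1}"
    and gamma: "0 \<le> \<gamma>" "\<gamma> < 1"
    and fst_psi: "\<And>h a. h \<in> histories R \<Longrightarrow> fst (\<psi> (h, a)) = f h"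
    and MDP: "abs_is_MDP R P \<psi> f p"
    and fibres_nonempty:
      "\<And>\<pi> h s. optimal_abs_policy R \<gamma> p (det_policy \<pi>) \<Longrightarrow> h \<in> histories R \<Longrightarrow> f h = s \<Longrightarrow>
         action_fibre \<psi> h s (\<pi> s) \<noteq> {}"
begin

text \<open>Tuples nest to the right, so with z = (ob, r) the appended entry \<open>(a, z)\<close>
  is the history step \<open>(a, ob, r)\<close>.\<close>

sublocale hist: decision_process P "\<lambda>h a z. h @ [(a, z)]" "UNIV \<times> R" \<gamma>
  using R gamma by unfold_locales auto

sublocale abs: decision_process p "\<lambda>_ _. fst" "UNIV \<times> R" \<gamma>
  using R gamma by unfold_locales auto

lemma Q_backup_eq: "Q_backup R \<gamma> P = hist.backup"
  by (intro ext) (simp add: Q_backup_def hist.backup_def case_prod_beta)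

lemma V_pol_eq: "V_pol R \<gamma> P = hist.policy_value"
  by (intro ext) (simp add: V_pol_def hist.policy_value_def Q_backup_eq)

lemma q_backup_eq: "q_backup R \<gamma> p = abs.backup"
  by (intro ext) (simp add: q_backup_def abs.backup_def case_prod_beta)

text \<open>\<open>v_pol\<close> imposes no boundedness; on finitely many states it is automatic, so
  both descriptions single out the same function.\<close>

lemma v_pol_eq: "v_pol R \<gamma> p = abs.policy_value"
  by (intro ext) (simp add: v_pol_def abs.policy_value_def q_backup_eq finite_imp_bounded)

lemma optimal_policy_iff:
  "optimal_policy R \<gamma> P pol \<longleftrightarrow> (\<forall>h\<in>histories R. V_pol R \<gamma> P pol h = hist.optimal_value h)"
  unfolding optimal_policy_def V_pol_eq by (rule hist.dominating_policy_iff)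

lemma optimal_abs_policy_iff:
  "optimal_abs_policy R \<gamma> p \<pi> \<longleftrightarrow> v_pol R \<gamma> p \<pi> = abs.optimal_value"
  using abs.dominating_policy_iff[of UNIV \<pi>]
  by (auto simp: optimal_abs_policy_def v_pol_eq fun_eq_iff)

text \<open>A greedy policy is optimal, so the choice operator in \<open>V_opt\<close> does pick an
  optimal policy. Its value is determined on genuine histories.\<close>

lemma V_opt_eq: "h \<in> histories R \<Longrightarrow> V_opt R \<gamma> P h = hist.optimal_value h"
proof -
  obtain g where "hist.policy_value (det_policy g) = hist.optimal_value"
    using hist.ex_greedy hist.policy_value_greedy by blast
  then have "optimal_policy R \<gamma> P (det_policy g)"
    by (simp add: optimal_policy_iff V_pol_eq)
  then have "optimal_policy R \<gamma> P (SOME pol. optimal_policy R \<gamma> P pol)"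
    by (rule someI[of "optimal_policy R \<gamma> P"])
  then show "h \<in> histories R \<Longrightarrow> V_opt R \<gamma> P h = hist.optimal_value h"
    by (simp add: optimal_policy_iff V_opt_def)
qed

lemma v_opt_eq: "v_opt R \<gamma> p = abs.optimal_value"
proof -
  obtain g where "abs.policy_value (det_policy g) = abs.optimal_value"
    using abs.ex_greedy abs.policy_value_greedy by blast
  then have "optimal_abs_policy R \<gamma> p (det_policy g)"
    by (simp add: optimal_abs_policy_iff v_pol_eq)
  then have "optimal_abs_policy R \<gamma> p (SOME \<pi>. optimal_abs_policy R \<gamma> p \<pi>)"
    by (rule someI[of "optimal_abs_policy R \<gamma> p"])
  then show ?thesis
    by (simp add: optimal_abs_policy_iff v_opt_def)
qed

lemma q_opt_eq: "q_opt R \<gamma> p = abs.backup abs.optimal_value"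
  unfolding q_opt_def q_pol_def v_opt_def[symmetric] by (simp add: v_opt_eq q_backup_eq)

lemma history_step: "h \<in> histories R \<Longrightarrow> z \<in> UNIV \<times> R \<Longrightarrow> h @ [(a, z)] \<in> histories R"
  by (auto simp: histories_def)

text \<open>A backup at a genuine history consults the value only at one-step extensions with
  rewards in \<open>R\<close>, which are genuine again.\<close>

lemma Q_opt_eq:
  "h \<in> histories R \<Longrightarrow> Q_opt R \<gamma> P h a = hist.backup hist.optimal_value h a"
  unfolding Q_opt_def Q_pol_def V_opt_def[symmetric] Q_backup_eq
  by (intro hist.backup_cong V_opt_eq history_step)

text \<open>For a fixed reward, group the observations by the abstract state they lead to. The
  factor r + \<gamma> * v s' is constant on each group, and the probabilities in it add up to
  \<open>P_abs\<close>, which the MDP property replaces by \<open>p\<close>.\<close>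

lemma backup_lift:
  assumes h: "h \<in> histories R" and ha: "\<psi> (h, a) = (s, b)"
  shows "hist.backup (\<lambda>h. v (f h)) h a = abs.backup v s b"
proof -
  have "hist.backup (\<lambda>h. v (f h)) h a =
      (\<Sum>ob\<in>UNIV. \<Sum>r\<in>R. pmf (P h a) (ob, r) * (r + \<gamma> * v (f (h @ [(a, ob, r)]))))"
    unfolding hist.backup_def by (simp add: sum.cartesian_product case_prod_beta)
  also have "\<dots> = (\<Sum>r\<in>R. \<Sum>ob\<in>UNIV. pmf (P h a) (ob, r) * (r + \<gamma> * v (f (h @ [(a, ob, r)]))))"
    by (rule sum.swap)
  also have "\<dots> = (\<Sum>r\<in>R. \<Sum>s'\<in>UNIV. pmf (p s b) (s', r) * (r + \<gamma> * v s'))"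
  proof (rule sum.cong[OF refl])
    fix r assume r: "r \<in> R"
    let ?g = "\<lambda>ob. f (h @ [(a, ob, r)])"
    let ?F = "\<lambda>ob. pmf (P h a) (ob, r) * (r + \<gamma> * v (?g ob))"
    have "(\<Sum>ob\<in>UNIV. ?F ob) = (\<Sum>s'\<in>UNIV. \<Sum>ob | ob \<in> UNIV \<and> ?g ob = s'. ?F ob)"
      by (rule sum.group[symmetric]) auto
    also have "\<dots> = (\<Sum>s'\<in>UNIV. P_abs P f h a s' r * (r + \<gamma> * v s'))"
      by (auto simp: P_abs_def sum_distrib_right intro!: sum.cong)
    also have "\<dots> = (\<Sum>s'\<in>UNIV. pmf (p s b) (s', r) * (r + \<gamma> * v s'))"
      using MDP h ha r by (simp add: abs_is_MDP_def)
    finally show "(\<Sum>ob\<in>UNIV. ?F ob) = (\<Sum>s'\<in>UNIV. pmf (p s b) (s', r) * (r + \<gamma> * v s'))" .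
  qed
  also have "\<dots> = abs.backup v s b"
    unfolding abs.backup_def by (subst sum.swap) (simp add: sum.cartesian_product case_prod_beta)
  finally show ?thesis .
qed

text \<open>
  Off the genuine histories the two functions may differ, so the uniqueness of bounded fixed points
  has to be localised to a set that is closed under the transitions.
\<close>

lemma eq_on_histories:
  assumes V: "bounded (range V)"
    and step_le: "\<And>h. h \<in> histories R \<Longrightarrow> \<exists>a. V h \<le> hist.backup V h a \<and>
       hist.backup (\<lambda>h. v (f h)) h a \<le> v (f h)"
    and step_ge: "\<And>h. h \<in> histories R \<Longrightarrow> \<exists>a. v (f h) \<le> hist.backup (\<lambda>h. v (f h)) h a \<and>
       hist.backup V h a \<le> V h"
    and h: "h \<in> histories R"
  shows "V h = v (f h)"
proof (rule order_antisym)
  have bv: "bounded (range (\<lambda>h. v (f h)))"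
    by (rule finite_imp_bounded, rule finite_subset[of _ "range v"]) auto
  show "V h \<le> v (f h)"
  proof -
    obtain C where C: "\<And>x. V x \<le> v (f x) + C"
      using bounded_le_plus[OF V bv] by blast
    show ?thesis
    proof (rule le_of_discounted_improvement[where X = "histories R", OF gamma C _ h])
      fix c and h :: "('a, 'o) history"
      assume "0 \<le> c" and le: "\<And>y. y \<in> histories R \<Longrightarrow> V y \<le> v (f y) + c"
        and h: "h \<in> histories R"
      obtain a where a: "V h \<le> hist.backup V h a" "hist.backup (\<lambda>h. v (f h)) h a \<le> v (f h)"
        using step_le[OF h] by blast
      \<comment> \<open>The same action bounds both sides, so the values are compared through one
        backup: V h is at most the backup of \<open>V\<close>, which is at most the backup of
        \<open>v\<close> after \<open>f\<close> plus \<gamma> * c.\<close>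
      have "hist.backup V h a \<le> hist.backup (\<lambda>h. v (f h)) h a + \<gamma> * c"
        using \<open>0 \<le> c\<close> by (intro hist.backup_le le history_step h)
      with a show "V h \<le> v (f h) + \<gamma> * c" by linarith
    qed
  qed
  show "v (f h) \<le> V h"
  proof -
    obtain C where C: "\<And>x. v (f x) \<le> V x + C"
      using bounded_le_plus[OF bv V] by blast
    show ?thesis
    proof (rule le_of_discounted_improvement
        [where X = "histories R" and V = "\<lambda>h. v (f h)", OF gamma C _ h])
      fix c and h :: "('a, 'o) history"
      assume "0 \<le> c" and le: "\<And>y. y \<in> histories R \<Longrightarrow> v (f y) \<le> V y + c"
        and h: "h \<in> histories R"
      obtain a where a: "v (f h) \<le> hist.backup (\<lambda>h. v (f h)) h a" "hist.backup V h a \<le> V h"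
        using step_ge[OF h] by blast
      have "hist.backup (\<lambda>h. v (f h)) h a \<le> hist.backup V h a + \<gamma> * c"
        using \<open>0 \<le> c\<close> by (intro hist.backup_le le history_step h)
      with a show "v (f h) \<le> V h + \<gamma> * c" by linarith
    qed
  qed
qed

text \<open>The two inequalities use different actions. For the upper bound take a greedy action on
  the history level: its abstract image cannot beat the abstract maximum. For the lower bound take
  an action lying over a greedy abstract action.\<close>

lemma optimal_value_lift:
  assumes h: "h \<in> histories R"
  shows "hist.optimal_value h = abs.optimal_value (f h)"
proof (rule eq_on_histories[OF hist.optimal_value_bounded _ _ h])
  fix h :: "('a, 'o) history" assume h: "h \<in> histories R"
  have psi: "\<psi> (h, a) = (f h, snd (\<psi> (h, a)))" for a
    using fst_psi[OF h] by (metis prod.collapse)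
  obtain g where "\<And>h. hist.backup hist.optimal_value h (g h) = hist.optimal_value h"
    using hist.ex_greedy by blast
  then show "\<exists>a. hist.optimal_value h \<le> hist.backup hist.optimal_value h a \<and>
      hist.backup (\<lambda>h. abs.optimal_value (f h)) h a \<le> abs.optimal_value (f h)"
    using backup_lift[OF h psi] abs.backup_le_optimal_value by (metis order_refl)
  obtain \<pi> where \<pi>: "\<And>s. abs.backup abs.optimal_value s (\<pi> s) = abs.optimal_value s"
    using abs.ex_greedy by blast
  \<comment> \<open>Nonempty fibres are assumed over optimal abstract policies only, so the greedy
    one must first be shown optimal.\<close>
  then have "optimal_abs_policy R \<gamma> p (det_policy \<pi>)"
    by (simp add: optimal_abs_policy_iff v_pol_eq abs.policy_value_greedy)
  from fibres_nonempty[OF this h refl] obtain a where "\<psi> (h, a) = (f h, \<pi> (f h))"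
    by (auto simp: action_fibre_def)
  then show "\<exists>a. abs.optimal_value (f h) \<le> hist.backup (\<lambda>h. abs.optimal_value (f h)) h a \<and>
      hist.backup hist.optimal_value h a \<le> hist.optimal_value h"
    using backup_lift[OF h] \<pi> hist.backup_le_optimal_value by (metis order_refl)
qed

text \<open>Here the single action \<open>pol h\<close> serves both inequalities, because both
  functions equal their own backup at it.\<close>

lemma policy_value_lift:
  assumes opt: "optimal_abs_policy R \<gamma> p (det_policy \<pi>)"
    and lift: "lifts_policy R \<psi> f \<pi> pol"
    and h: "h \<in> histories R"
  shows "hist.policy_value (det_policy pol) h = abs.optimal_value (f h)"
proof (rule eq_on_histories[OF hist.policy_value_bounded _ _ h])
  fix h :: "('a, 'o) history" assume h: "h \<in> histories R"
  let ?V = "hist.policy_value (det_policy pol)" and ?v = "\<lambda>h. abs.optimal_value (f h)"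
  have "\<psi> (h, pol h) = (f h, \<pi> (f h))"
    using lift h by (simp add: lifts_policy_def action_fibre_def)
  \<comment> \<open>An optimal \<pi> has the optimal value as its policy value, so its policy
    equation shows that the optimal value at s is attained by the action \<pi> s.\<close>
  from backup_lift[OF h this] have "hist.backup ?v h (pol h) = ?v h"
    using opt abs.policy_value_det[of \<pi> "f h"] by (simp add: optimal_abs_policy_iff v_pol_eq)
  moreover have "hist.backup ?V h (pol h) = ?V h"
    by (rule hist.policy_value_det[symmetric])
  ultimately show "\<exists>a. ?V h \<le> hist.backup ?V h a \<and> hist.backup ?v h a \<le> ?v h"
    and "\<exists>a. ?v h \<le> hist.backup ?v h a \<and> hist.backup ?V h a \<le> ?V h"
    by (metis order_refl)+
qed

end

theorem theorem6:
  fixes R :: "real set" and \<gamma> :: real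
    and P :: "('a::finite, 'o::finite) process"
    and \<psi> :: "('a, 'o) history \<times> 'a \<Rightarrow> 's::finite \<times> 'b::finite"
    and f :: "('a, 'o) history \<Rightarrow> 's"
    and p :: "('s, 'b) mdp"
  assumes R: "finite R" "R \<subseteq> {0..1}"
    and gamma: "0 \<le> \<gamma>" "\<gamma> < 1"
    and P: "is_process R P"
    and hom: "homomorphism R \<psi> f"
    and MDP: "abs_is_MDP R P \<psi> f p"
    and fibres_nonempty:
      "\<And>\<pi> h s. optimal_abs_policy R \<gamma> p (det_policy \<pi>) \<Longrightarrow> h \<in> histories R \<Longrightarrow> f h = s \<Longrightarrow>
         action_fibre \<psi> h s (\<pi> s) \<noteq> {}"
  shows "\<forall>h\<in>histories R. \<forall>a s b. \<psi> (h, a) = (s, b) \<longrightarrow>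
      (q_opt R \<gamma> p s b = Q_opt R \<gamma> P h a \<and> v_opt R \<gamma> p s = V_opt R \<gamma> P h) \<and>
      (\<forall>\<pi> pol. optimal_abs_policy R \<gamma> p (det_policy \<pi>) \<and> lifts_policy R \<psi> f \<pi> pol \<longrightarrow>
         V_opt R \<gamma> P h = V_pol R \<gamma> P (det_policy pol) h)"
proof -
  interpret mdp_homomorphism R \<gamma> P \<psi> f p
    using R gamma hom MDP fibres_nonempty by unfold_locales (auto simp: homomorphism_def)
  show ?thesis
  proof (intro ballI allI impI conjI)
    fix h a s b assume h: "h \<in> histories R" and ha: "\<psi> (h, a) = (s, b)"
    have s: "s = f h" using fst_psi[OF h, of a] ha by simp
    show "v_opt R \<gamma> p s = V_opt R \<gamma> P h"
      by (simp add: v_opt_eq V_opt_eq[OF h] optimal_value_lift[OF h] s)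
    \<comment> \<open>The optimal values are known to agree only on genuine histories, which is all
      that a backup at \<open>h\<close> consults.\<close>
    have "hist.backup hist.optimal_value h a = hist.backup (\<lambda>h. abs.optimal_value (f h)) h a"
      by (intro hist.backup_cong optimal_value_lift history_step h)
    then show "q_opt R \<gamma> p s b = Q_opt R \<gamma> P h a"
      by (simp add: q_opt_eq Q_opt_eq[OF h] backup_lift[OF h ha])
    fix \<pi> pol
    assume "optimal_abs_policy R \<gamma> p (det_policy \<pi>) \<and> lifts_policy R \<psi> f \<pi> pol"
    then show "V_opt R \<gamma> P h = V_pol R \<gamma> P (det_policy pol) h"
      by (simp add: V_opt_eq[OF h] V_pol_eq optimal_value_lift[OF h] policy_value_lift[OF _ _ h, of \<pi> pol])
  qed
qed

end
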